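(* Let $G=\mathrm{SL}_3$ over $\mathbb{F}_q$ with diagonal torus $T$, let $V=\mathbb{A}^3$, $X=\{(v,v^\vee)\in V\times V^*:\langle v,v^\vee\rangle=0\}$, and let $\psi:\mathbb{F}_q\to\mathbb{C}^\times$ be a nontrivial additive character. Let $\mathcal{S}'(X(\mathbb{F}_q),\mathbb{C})$ be the space of functions $f:X(\mathbb{F}_q)\to\mathbb{C}$ such that for all $(v,v^\vee)\in X(\mathbb{F}_q)$ $$\sum_{\lambda\in\mathbb{F}_q^\times}f(\lambda v,v^\vee)=0,\qquad\sum_{\lambda\in\mathbb{F}_q^\times}f(v,\lambda v^\vee)=0,\qquad\sum_{\lambda\in\mathbb{F}_q^\times}f(\lambda v,\lambda v^\vee)=0.$$ There exists an action of $S_3=W_T(\mathrm{SL}_3)$ on $\mathcal{S}'(X(\mathbb{F}_q),\mathbb{C})$ which is $G$-equivariant, and $T$-equivariant under the right $T$-action twisted by $W$. It is generated by the two transformations, through which the simple reflections act, $$\mathcal{F}_{\alpha_1-\alpha_2}(f)(v,v^\vee)=q^{-1}\sum_{u\in(v^\vee)^\perp}f(u,v^\vee)\,\psi\left(\frac{u\times v}{v^\vee}\right),$$ $$\mathcal{F}_{\alpha_2-\alpha_3}(f)(v,v^\vee)=q^{-1}\sum_{u^\vee\in v^\perp}f(v,u^\vee)\,\psi\left(\frac{u^\vee\times v^\vee}{v}\right),$$ while the longest element $w_0$ of $W$ acts via the quadratic Kloosterman Fourier transform $$\mathcal{F}_{w_0}(f)(v,v^\vee)=q^{-3}\sum_{(u,u^\vee)\in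 X(\mathbb{F}_q)}f(u,u^\vee)\,\mathrm{Kl}\big(\langle u,v^\vee\rangle+\langle v,u^\vee\rangle\big).$$
   Context: $\mathrm{Kl}(a)=\sum_{t\in\mathbb{F}_q^\times}\psi\left(\frac at+t\right)$. $V$ and $V^*$ are both identified with $\mathbb{F}_q^3$ so that the pairing is the dot product; $\times$ is the cross product, and for $c\ne0$ and $a,b$ orthogonal to $c$, $\frac{a\times b}{c}$ denotes the scalar $\mu$ with $a\times b=\mu c$. By convention $\mathcal{F}_{\alpha_1-\alpha_2}(f)(v,0)=0$ and $\mathcal{F}_{\alpha_2-\alpha_3}(f)(0,v^\vee)=0$ (functions in $\mathcal{S}'$ vanish when $v=0$ or $v^\vee=0$). $X$ is the affine closure of $G/U$, $U$ the upper triangular unipotent group, via $gU\mapsto$ (first column of $g$, third row of $g^{-1}$). Accordingly $g\in G$ acts on $X$ by $(v,v^\vee)\mapsto(gv,v^\vee g^{-1})$ (with $v^\vee$ a row vector), and $t=\mathrm{diag}(t_1,t_2,t_3)\in T$ acts on the right by $(v,v^\vee)\cdot t=(t_1v,t_3^{-1}v^\vee)$; write $(R_tf)(x)=f(x\cdot t)$. "$G$-equivariant" means that the operators commute with the action $f\mapsto f(g^{-1}\,\cdot)$ of $G(\mathbb{F}_q)$. "$T$-equivariant under the right $T$-action twisted by $W$" means that the operator $\mathcal{F}_w$ by which $w\in S_3$ acts satisfies $\mathcal{F}_w\circ R_t=R_{w(t)}\circ\mathcal{F}_w$, where $W=S_3$ acts on $T(\mathbb{F}_q)$ by permuting diagonal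 entries. The simple reflections attached to $\alpha_1-\alpha_2$ and $\alpha_2-\alpha_3$ are $(1\,2)$ and $(2\,3)$. *)

theory Defs
  imports "HOL-Analysis.Determinants" "HOL-Algebra.Group_Action" "HOL-Algebra.Generated_Groups"
    "HOL-Combinatorics.Transposition"
begin

text \<open>
  The finite field \<open>\<bbbF>\<^sub>q\<close> is an arbitrary type of sort \<open>{field, finite}\<close>, so \<open>q = CARD('a)\<close>.
  The index type \<open>3\<close> has the elements \<open>1\<close>, \<open>2\<close>, \<open>3\<close> (where \<open>3 = 0\<close>).
\<close>

type_synonym 'a pt = "('a ^ 3) \<times> ('a ^ 3)"

definition nontrivial_additive_character :: "('a::field \<Rightarrow> complex) \<Rightarrow> bool" where
  "nontrivial_additive_character \<psi> \<longleftrightarrow>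
     (\<forall>x. \<psi> x \<noteq> 0) \<and> (\<forall>x y. \<psi> (x + y) = \<psi> x * \<psi> y) \<and> (\<exists>x. \<psi> x \<noteq> 1)"

definition Kl :: "('a::{field,finite} \<Rightarrow> complex) \<Rightarrow> 'a \<Rightarrow> complex" where
  "Kl \<psi> a = (\<Sum>t\<in>UNIV - {0}. \<psi> (a / t + t))"

definition pairing :: "'a::field ^ 3 \<Rightarrow> 'a ^ 3 \<Rightarrow> 'a" where
  "pairing v w = (\<Sum>i\<in>UNIV. v $ i * w $ i)"

definition cross :: "'a::field ^ 3 \<Rightarrow> 'a ^ 3 \<Rightarrow> 'a ^ 3" where
  "cross a b =
     vector [a$2 * b$3 - a$3 * b$2, a$3 * b$1 - a$1 * b$3, a$1 * b$2 - a$2 * b$1]"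

text \<open>Only meaningful for \<open>c \<noteq> 0\<close> and \<open>a\<close>, \<open>b\<close> orthogonal to \<open>c\<close>.\<close>
definition cross_quot :: "'a::field ^ 3 \<Rightarrow> 'a ^ 3 \<Rightarrow> 'a ^ 3 \<Rightarrow> 'a" where
  "cross_quot a b c = (THE \<mu>. cross a b = \<mu> *s c)"

definition X :: "('a::field pt) set" where
  "X = {(v, w). pairing v w = 0}"

text \<open>A function on \<open>X\<close> is represented by its extension by zero to all pairs.\<close>
definition S' :: "('a::{field,finite} pt \<Rightarrow> complex) set" where
  "S' = {f. (\<forall>x. x \<notin> X \<longrightarrow> f x = 0) \<and>
     (\<forall>(v, w)\<in>X.
        (\<Sum>c\<in>UNIV - {0}. f (c *s v, w)) = 0 \<and>
        (\<Sum>c\<in>UNIV - {0}. f (v, c *s w)) = 0 \<and>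
        (\<Sum>c\<in>UNIV - {0}. f (c *s v, c *s w)) = 0)}"

definition SL3 :: "('a::field ^ 3 ^ 3) set" where
  "SL3 = {g. det g = 1}"

definition T :: "('a::field ^ 3 ^ 3) set" where
  "T = {t \<in> SL3. \<forall>i j. i \<noteq> j \<longrightarrow> t $ i $ j = 0}"

definition actG :: "'a::field ^ 3 ^ 3 \<Rightarrow> 'a pt \<Rightarrow> 'a pt" where
  "actG g = (\<lambda>(v, w). (g *v v, w v* matrix_inv g))"

definition L :: "'a::field ^ 3 ^ 3 \<Rightarrow> ('a pt \<Rightarrow> complex) \<Rightarrow> 'a pt \<Rightarrow> complex" where
  "L g f = (\<lambda>x. f (actG (matrix_inv g) x))"

definition actT :: "'a::field pt \<Rightarrow> 'a ^ 3 ^ 3 \<Rightarrow> 'a pt" where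
  "actT = (\<lambda>(v, w) t. ((t $ 1 $ 1) *s v, inverse (t $ 3 $ 3) *s w))"

definition R :: "'a::field ^ 3 ^ 3 \<Rightarrow> ('a pt \<Rightarrow> complex) \<Rightarrow> 'a pt \<Rightarrow> complex" where
  "R t f = (\<lambda>x. f (actT x t))"

text \<open>
  Conjugation by the permutation matrix of \<open>w\<close>: it moves the diagonal entry at position \<open>i\<close> to
  position \<open>w i\<close>.  The inverse makes this a left action of the symmetric group.
\<close>
definition permT :: "(3 \<Rightarrow> 3) \<Rightarrow> 'a::field ^ 3 ^ 3 \<Rightarrow> 'a ^ 3 ^ 3" where
  "permT w t = (\<chi> i j. t $ inv_into UNIV w i $ inv_into UNIV w j)"

abbreviation S3 :: "(3 \<Rightarrow> 3) monoid" where
  "S3 \<equiv> BijGroup UNIV"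

definition s12 :: "3 \<Rightarrow> 3" where "s12 = Transposition.transpose 1 2"
definition s23 :: "3 \<Rightarrow> 3" where "s23 = Transposition.transpose 2 3"

text \<open>The longest element, i.e. the order-reversing permutation of \<open>1\<close>, \<open>2\<close>, \<open>3\<close>.\<close>
definition w0 :: "3 \<Rightarrow> 3" where "w0 = Transposition.transpose 1 3"

text \<open>
  The following three operators produce functions vanishing off \<open>X\<close>.  The value of \<open>F12\<close> at
  \<open>w = 0\<close> and that of \<open>F23\<close> at \<open>v = 0\<close> is zero by convention.
\<close>
definition F12 :: "('a::{field,finite} \<Rightarrow> complex) \<Rightarrow>
    ('a pt \<Rightarrow> complex) \<Rightarrow> 'a pt \<Rightarrow> complex" where
  "F12 \<psi> f = (\<lambda>(v, w). if (v, w) \<in> X \<and> w \<noteq> 0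
     then (\<Sum>u | pairing u w = 0. f (u, w) * \<psi> (cross_quot u v w)) / of_nat CARD('a)
     else 0)"

definition F23 :: "('a::{field,finite} \<Rightarrow> complex) \<Rightarrow>
    ('a pt \<Rightarrow> complex) \<Rightarrow> 'a pt \<Rightarrow> complex" where
  "F23 \<psi> f = (\<lambda>(v, w). if (v, w) \<in> X \<and> v \<noteq> 0
     then (\<Sum>u | pairing v u = 0. f (v, u) * \<psi> (cross_quot u w v)) / of_nat CARD('a)
     else 0)"

definition Fw0 :: "('a::{field,finite} \<Rightarrow> complex) \<Rightarrow>
    ('a pt \<Rightarrow> complex) \<Rightarrow> 'a pt \<Rightarrow> complex" where
  "Fw0 \<psi> f = (\<lambda>(v, w). if (v, w) \<in> X
     then (\<Sum>(u, u')\<in>X. f (u, u') * Kl \<psi> (pairing u w + pairing v u')) / of_nat CARD('a) ^ 3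
     else 0)"

end

theory Submission
  imports Defs
begin

text \<open>
  For fixed \<open>w \<noteq> 0\<close> the plane \<open>w\<^sup>\<bottom>\<close> carries the symplectic form \<open>cross_quot u v w\<close>, and \<open>F12\<close> is the
  symplectic Fourier transform on it, which is an involution.  Exchanging \<open>V\<close> and its dual
  conjugates \<open>F12\<close> to \<open>F23\<close> and fixes \<open>Fw0\<close>, so both braid words equal \<open>Fw0\<close> as soon as one does.
  The kernel of \<open>F12 \<circ> F23 \<circ> F12\<close> from \<open>(x, y)\<close> to \<open>(v, w)\<close> is a sum over the nonzero \<open>u\<close>
  orthogonal to \<open>w\<close> and \<open>y\<close>.  If \<open>y\<close> and \<open>w\<close> are independent, then \<open>u\<close> runs over the
  multiples \<open>t\<^sup>-\<^sup>1 (y \<times> w)\<close> and the sum is a Kloosterman sum; if \<open>y = c w\<close>, it exceeds the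
  Kloosterman value \<open>-1\<close> by \<open>q\<^sup>2\<close> exactly when \<open>x = c v\<close>, and this excess is annihilated by the
  condition on \<open>\<Sum>\<^sub>c f (c v, c w)\<close> that defines \<open>S'\<close>.
\<close>

subsection \<open>Dot and cross products\<close>

lemma pairing_3: "pairing v w = v$1 * w$1 + v$2 * w$2 + v$3 * w$3"
  by (simp add: pairing_def sum_3)

lemma pairing_commute: "pairing v w = pairing w v"
  by (simp add: pairing_3 mult.commute)

lemma pairing_add_left: "pairing (u + v) w = pairing u w + pairing v w"
  by (simp add: pairing_3 algebra_simps)

lemma pairing_diff_left: "pairing (u - v) w = pairing u w - pairing v w"
  by (simp add: pairing_3 algebra_simps)

lemma pairing_scale_left: "pairing (c *s v) w = c * pairing v w"
  by (simp add: pairing_3 algebra_simps)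

lemma pairing_scale_right: "pairing v (c *s w) = c * pairing v w"
  by (simp add: pairing_3 algebra_simps)

lemma pairing_0 [simp]: "pairing 0 w = 0" "pairing v 0 = 0"
  by (simp_all add: pairing_3)

lemma cross_components:
  "cross a b $ 1 = a$2 * b$3 - a$3 * b$2"
  "cross a b $ 2 = a$3 * b$1 - a$1 * b$3"
  "cross a b $ 3 = a$1 * b$2 - a$2 * b$1"
  by (simp_all add: cross_def)

lemma cross_add_left: "cross (a + b) c = cross a c + cross b c"
  and cross_diff_right: "cross a (b - c) = cross a b - cross a c"
  and cross_scale_left: "cross (k *s a) b = k *s cross a b"
  and cross_scale_right: "cross a (k *s b) = k *s cross a b"
  and cross_swap: "cross a b = - cross b a"
  and cross_0_right [simp]: "cross a 0 = 0"
  by (simp_all add: vec_eq_iff forall_3 cross_components algebra_simps)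

lemma cross_cross: "cross a (cross b c) = pairing a c *s b - pairing a b *s c"
  by (simp add: vec_eq_iff forall_3 cross_components pairing_3 algebra_simps)

lemma pairing_cross_left: "pairing (cross a b) a = 0"
  and pairing_cross_right: "pairing (cross a b) b = 0"
  by (simp_all add: cross_components pairing_3 algebra_simps)

text \<open>A nonzero coordinate of \<open>a\<close> fixes the ratio, and the vanishing 2x2 minors
  force the other two coordinates to obey it.\<close>

lemma parallel_if_cross_eq_0:
  assumes "a \<noteq> 0" "cross a b = 0"
  obtains k where "b = k *s a"
proof -
  have c: "a$2 * b$3 = a$3 * b$2" "a$3 * b$1 = a$1 * b$3" "a$1 * b$2 = a$2 * b$1"
    using assms(2) by (simp_all add: vec_eq_iff forall_3 cross_components)
  from assms(1) consider "a$1 \<noteq> 0" | "a$2 \<noteq> 0" | "a$3 \<noteq> 0"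
    by (auto simp: vec_eq_iff forall_3)
  then show thesis
  proof cases
    case 1
    then show thesis using c
      by (intro that[of "b$1 / a$1"]) (simp add: vec_eq_iff forall_3 field_simps)
  next
    case 2
    then show thesis using c
      by (intro that[of "b$2 / a$2"]) (simp add: vec_eq_iff forall_3 field_simps)
  next
    case 3
    then show thesis using c
      by (intro that[of "b$3 / a$3"]) (simp add: vec_eq_iff forall_3 field_simps)
  qed
qed

lemma scale_right_cancel: "(w::'a::field ^ 3) \<noteq> 0 \<Longrightarrow> a *s w = b *s w \<longleftrightarrow> a = b"
  by (auto simp: vec_eq_iff)

lemma cross_quot_eqI: "w \<noteq> 0 \<Longrightarrow> cross u v = \<mu> *s w \<Longrightarrow> cross_quot u v w = \<mu>"
  by (auto simp: cross_quot_def scale_right_cancel)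

text \<open>\<open>cross_quot\<close> is a definite description, so equivalent defining equations
  give equal values even where no quotient exists. Changes of variables thus need no orthogonality
  hypotheses.\<close>

lemma cross_quot_cong:
  assumes "\<And>\<mu>. cross u v = \<mu> *s w \<longleftrightarrow> cross u' v' = \<mu> *s w'"
  shows "cross_quot u v w = cross_quot u' v' w'"
  using assms by (simp add: cross_quot_def)

text \<open>The triple product w x (u x v) expands into multiples of \<open>pairing w v\<close> and
  \<open>pairing w u\<close>, both zero, so u x v is parallel to w.\<close>

lemma cross_eq_cross_quot:
  assumes "w \<noteq> 0" "pairing u w = 0" "pairing v w = 0"
  shows "cross u v = cross_quot u v w *s w"
proof -
  have "cross w (cross u v) = 0"
    using assms by (simp add: cross_cross pairing_commute[of w])
  then obtain k where "cross u v = k *s w"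
    using parallel_if_cross_eq_0 assms(1) by blast
  then show ?thesis using cross_quot_eqI assms(1) by metis
qed

text \<open>The two defining equations differ by the factor \<open>b\<close>. This is the change of
  phase behind the substitution in \<open>F12_scale\<close>.\<close>

lemma cross_quot_scale:
  assumes "a \<noteq> 0" "b \<noteq> 0"
  shows "cross_quot (inverse a *s u) v w = cross_quot u ((b / a) *s v) (b *s w)"
  using assms by (intro cross_quot_cong)
    (auto simp: cross_scale_left cross_scale_right vec_eq_iff forall_3 field_simps)

subsection \<open>Additive characters\<close>

context
  fixes \<psi> :: "'a::{field,finite} \<Rightarrow> complex"
  assumes \<psi>: "nontrivial_additive_character \<psi>"
begin

lemma char_add: "\<psi> (x + y) = \<psi> x * \<psi> y"
  and char_nonzero: "\<psi> x \<noteq> 0"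
  using \<psi> by (simp_all add: nontrivial_additive_character_def)

lemma char_0: "\<psi> 0 = 1"
  using char_add[of 0 0] char_nonzero[of 0] by simp

lemma char_nontrivial: obtains c where "\<psi> c \<noteq> 1"
  using \<psi> by (auto simp: nontrivial_additive_character_def)

text \<open>Translation by \<open>c\<close> multiplies the sum by \<open>\<psi> c\<close>, which
  differs from 1.\<close>

lemma sum_char: "(\<Sum>x\<in>UNIV. \<psi> x) = 0"
proof -
  obtain c where c: "\<psi> c \<noteq> 1" by (rule char_nontrivial)
  have "(\<Sum>x\<in>UNIV. \<psi> x) = (\<Sum>x\<in>UNIV. \<psi> (x + c))"
    by (rule sum.reindex_bij_witness[of _ "\<lambda>x. x + c" "\<lambda>x. x - c"]) auto
  also have "\<dots> = \<psi> c * (\<Sum>x\<in>UNIV. \<psi> x)"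
    by (simp add: char_add sum_distrib_left mult.commute)
  finally show ?thesis using c by simp
qed

text \<open>At 0 the summand is \<open>\<psi> t\<close>, so what remains is the full character sum 0
  minus its term 1 at \<open>t = 0\<close>.\<close>

lemma Kl_0: "Kl \<psi> 0 = -1"
  using sum.remove[of UNIV 0 \<psi>] by (simp add: Kl_def sum_char char_0 eq_neg_iff_add_eq_0 add.commute)

end

section \<open>Character sums over the plane orthogonal to a nonzero vector\<close>

lemma card_perp:
  fixes w :: "'a::{field,finite} ^ 3"
  assumes "w \<noteq> 0"
  shows "card {u. pairing u w = 0} = CARD('a)\<^sup>2"
proof -
  obtain i where i: "w $ i \<noteq> 0" using assms by (auto simp: vec_eq_iff)
  \<comment> \<open>A vector pairing to 1 with \<open>w\<close> splits the whole space into its line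
    and the plane, so the plane has q^3 / q points.\<close>
  define e where "e = axis i (inverse (w $ i))"
  have e: "pairing e w = 1"
    using i exhaust_3[of i] by (auto simp: e_def pairing_3 axis_def)
  have "bij_betw (\<lambda>(c, u). c *s e + u) (UNIV \<times> {u. pairing u w = 0}) UNIV"
    by (rule bij_betw_byWitness[where f' = "\<lambda>x. (pairing x w, x - pairing x w *s e)"])
      (auto simp: pairing_add_left pairing_diff_left pairing_scale_left e)
  then have "CARD('a) * card {u. pairing u w = 0} = CARD('a ^ 3)"
    using bij_betw_same_card by (fastforce simp: card_cartesian_product)
  also have "\<dots> = CARD('a) * CARD('a)\<^sup>2"
    by (simp add: power3_eq_cube power2_eq_square)
  finally show ?thesis by (simp del: zero_less_card_finite)
qed

text \<open>Orthogonality of characters: the form is nondegenerate on the plane, so a nonzero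
  \<open>d\<close> defines a nontrivial character of it.\<close>

lemma sum_char_symplectic:
  fixes w d :: "'a::{field,finite} ^ 3"
  assumes \<psi>: "nontrivial_additive_character \<psi>"
    and w: "w \<noteq> 0" and d: "pairing d w = 0"
  shows "(\<Sum>u | pairing u w = 0. \<psi> (cross_quot u d w)) = (if d = 0 then of_nat CARD('a) ^ 2 else 0)"
proof (cases "d = 0")
  case True
  have "cross_quot u 0 w = 0" for u
    using w by (intro cross_quot_eqI) auto
  with True w show ?thesis by (simp add: char_0[OF \<psi>] card_perp)
next
  case False
  obtain c where c: "\<psi> c \<noteq> 1" by (rule char_nontrivial[OF \<psi>])
  obtain i where i: "d $ i \<noteq> 0" using False by (auto simp: vec_eq_iff)
  \<comment> \<open>With d . z = -c, the vector w x z of the plane satisfies d x (w x z) = (d . z) w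
    - (d . w) z = -c w; translating by it therefore adds \<open>c\<close> to the form.\<close>
  define z where "z = axis i (- c / d $ i)"
  have z: "pairing d z = -c"
    using i exhaust_3[of i] by (auto simp: z_def pairing_3 axis_def)
  let ?u = "cross w z"
  have u: "pairing ?u w = 0" by (rule pairing_cross_left)
  have "cross ?u d = c *s w"
    using d z by (simp add: cross_swap[of ?u] cross_cross)
  then have *: "cross_quot (x + ?u) d w = cross_quot x d w + c" if "pairing x w = 0" for x
    using w d that cross_eq_cross_quot[of w x d]
    by (intro cross_quot_eqI) (simp_all add: cross_add_left vector_sadd_rdistrib)
  let ?S = "\<Sum>x | pairing x w = 0. \<psi> (cross_quot x d w)"
  have "?S = (\<Sum>x | pairing x w = 0. \<psi> (cross_quot (x + ?u) d w))"
    by (rule sum.reindex_bij_witness[of _ "\<lambda>x. x + ?u" "\<lambda>x. x - ?u"])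
      (auto simp: pairing_add_left pairing_diff_left u)
  also have "\<dots> = \<psi> c * ?S"
    by (simp add: * char_add[OF \<psi>] sum_distrib_left mult.commute)
  finally show ?thesis using c False by simp
qed

subsection \<open>The special linear group\<close>

lemma bij_matrix_vector_mult: "det g \<noteq> 0 \<Longrightarrow> bij ((*v) (g::'a::field ^ 'n ^ 'n))"
  using invertible_det_nz[of g] invertible_eq_bij by blast

lemma det_1_matrix_inv:
  fixes h :: "'a::field ^ 'n ^ 'n"
  assumes "det h = 1"
  shows "h ** matrix_inv h = mat 1" "matrix_inv h ** h = mat 1" "det (matrix_inv h) = 1"
proof -
  have "invertible h" using assms by (simp add: invertible_det_nz)
  then show *: "h ** matrix_inv h = mat 1" "matrix_inv h ** h = mat 1"
    using someI_ex[of "\<lambda>A'. h ** A' = mat 1 \<and> A' ** h = mat 1"]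
    by (simp_all add: matrix_inv_def invertible_def)
  from *(1) assms show "det (matrix_inv h) = 1"
    by (metis det_I det_mul mult_1)
qed

lemma vector_matrix_mult_component_3:
  fixes k :: "'a::field ^ 3 ^ 3"
  shows "(w v* k) $ j = k$1$j * w$1 + k$2$j * w$2 + k$3$j * w$3"
  by (simp add: vector_matrix_mult_def sum_3)

lemma matrix_vector_mult_component_3:
  fixes k :: "'a::field ^ 3 ^ 3"
  shows "(k *v w) $ i = k$i$1 * w$1 + k$i$2 * w$2 + k$i$3 * w$3"
  by (simp add: matrix_vector_mult_def sum_3)

lemma pairing_matrix: "pairing (h *v v) w = pairing v (w v* h)"
  by (simp add: pairing_3 vector_matrix_mult_component_3 matrix_vector_mult_component_3 algebra_simps)

text \<open>The vector u x v represents the functional x -> det(u, v, x), and pulling this back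
  along \<open>h\<close> brings out the factor \<open>det h\<close>.\<close>

lemma cross_matrix_vector_mult:
  "cross (h *v u) (h *v v) v* h = det h *s cross u v"
  by (simp add: vec_eq_iff forall_3 cross_components det_3
      vector_matrix_mult_component_3 matrix_vector_mult_component_3 algebra_simps)

lemma cross_vector_matrix_mult:
  "k *v cross (u v* k) (v v* k) = det k *s cross u v"
  by (simp add: vec_eq_iff forall_3 cross_components det_3
      vector_matrix_mult_component_3 matrix_vector_mult_component_3 algebra_simps)

lemma vector_matrix_mult_scale: "(c *s w) v* (h::'a::field ^ 3 ^ 3) = c *s (w v* h)"
  by (simp add: vec_eq_iff vector_matrix_mult_component_3 algebra_simps)

subsection \<open>The transforms attached to the simple reflections\<close>

lemma mem_X: "(v, w) \<in> X \<longleftrightarrow> pairing v w = 0"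
  by (simp add: X_def)

lemma F12_outside: "pairing v w \<noteq> 0 \<Longrightarrow> F12 \<psi> f (v, w) = 0"
  and F12_0_right [simp]: "F12 \<psi> f (v, 0) = 0"
  by (simp_all add: F12_def mem_X)

lemma F12_apply:
  "pairing v w = 0 \<Longrightarrow> w \<noteq> 0 \<Longrightarrow>
   F12 \<psi> f (v, w) = (\<Sum>u | pairing u w = 0. f (u, w) * \<psi> (cross_quot u v w)) / of_nat CARD('a)"
  for \<psi> :: "'a::{field,finite} \<Rightarrow> complex"
  by (simp add: F12_def mem_X)

lemma F12_sum: "F12 \<psi> (\<lambda>x. \<Sum>c\<in>A. f c x) p = (\<Sum>c\<in>A. F12 \<psi> (f c) p)"
proof (cases p)
  case (Pair v w)
  show ?thesis
    by (auto simp: Pair F12_def sum_distrib_right sum_divide_distrib intro: sum.swap)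
qed

lemma F12_linear:
  "F12 \<psi> (\<lambda>x. a * f x + b * h x) = (\<lambda>x. a * F12 \<psi> f x + b * F12 \<psi> h x)"
  by (auto simp: F12_def fun_eq_iff add_divide_distrib sum_distrib_left sum.distrib algebra_simps
      simp flip: sum_divide_distrib)

lemma F12_0 [simp]: "F12 \<psi> (\<lambda>x. 0) p = 0"
  by (cases p) (simp add: F12_def)

text \<open>Substituting \<open>a *s u\<close> costs the form a factor 1/a, and replacing
  \<open>w\<close> by \<open>b *s w\<close> divides it by \<open>b\<close>; rescaling
  \<open>v\<close> by \<open>b / a\<close> makes up for both. The rule yields the stability of
  \<open>S'\<close> as well as the torus equivariance.\<close>

lemma F12_scale:
  assumes "a \<noteq> 0" "b \<noteq> 0"
  shows "F12 \<psi> (\<lambda>(v, w). f (a *s v, b *s w)) (v, w) = F12 \<psi> f ((b / a) *s v, b *s w)"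
proof (cases "pairing v w = 0 \<and> w \<noteq> 0")
  case True
  then have "b *s w \<noteq> 0" using assms by (simp add: vec_eq_iff)
  moreover have "(\<Sum>u | pairing u w = 0. f (a *s u, b *s w) * \<psi> (cross_quot u v w)) =
    (\<Sum>u | pairing u (b *s w) = 0. f (u, b *s w) * \<psi> (cross_quot u ((b / a) *s v) (b *s w)))"
    using assms
    by (intro sum.reindex_bij_witness[of _ "\<lambda>u. inverse a *s u" "\<lambda>u. a *s u"])
      (auto simp: pairing_scale_left pairing_scale_right simp flip: cross_quot_scale)
  ultimately show ?thesis using True assms
    by (simp add: F12_apply pairing_scale_left pairing_scale_right)
next
  case False
  then show ?thesis using assms
    by (auto simp: F12_outside pairing_scale_left pairing_scale_right)
qed

text \<open>The transform is built from the pairing and the cross product alone, so maps compatible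
  with both commute with it. Keeping \<open>\<alpha>\<close> and \<open>\<beta>\<close> abstract
  allows the roles of V and its dual to be exchanged, as \<open>F23\<close> requires.\<close>

lemma F12_equivariant:
  fixes \<alpha> \<beta> :: "'a::{field,finite} ^ 3 \<Rightarrow> 'a ^ 3"
  assumes "bij \<alpha>" and "inj \<beta>"
    and \<beta>: "\<And>c w. \<beta> (c *s w) = c *s \<beta> w"
    and pairing: "\<And>v w. pairing (\<alpha> v) (\<beta> w) = pairing v w"
    and cross: "\<And>u v. cross (\<alpha> u) (\<alpha> v) = \<beta> (cross u v)"
  shows "F12 \<psi> (\<lambda>(v, w). f (\<alpha> v, \<beta> w)) = (\<lambda>(v, w). F12 \<psi> f (\<alpha> v, \<beta> w))"
proof -
  have 0: "\<beta> w = 0 \<longleftrightarrow> w = 0" for w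
    using \<beta>[of 0 0] \<open>inj \<beta>\<close> by (auto simp: inj_def)
  have q: "cross_quot (\<alpha> u) (\<alpha> v) (\<beta> w) = cross_quot u v w" for u v w
    by (intro cross_quot_cong) (simp add: cross inj_eq[OF \<open>inj \<beta>\<close>] flip: \<beta>)
  define \<gamma> where "\<gamma> = inv_into UNIV \<alpha>"
  have \<gamma>: "\<alpha> (\<gamma> u) = u" "\<gamma> (\<alpha> u) = u" for u
    using \<open>bij \<alpha>\<close> by (simp_all add: \<gamma>_def bij_is_inj bij_is_surj surj_f_inv_f)
  have "pairing (\<gamma> u) w = pairing u (\<beta> w)" for u w
    using pairing[of "\<gamma> u" w] by (simp add: \<gamma>)
  then have "(\<Sum>u | pairing u w = 0. f (\<alpha> u, \<beta> w) * \<psi> (cross_quot u v w)) =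
    (\<Sum>u | pairing u (\<beta> w) = 0. f (u, \<beta> w) * \<psi> (cross_quot u (\<alpha> v) (\<beta> w)))" for v w
    by (intro sum.reindex_bij_witness[of _ \<gamma> \<alpha>]) (simp_all add: q \<gamma> pairing)
  then show ?thesis
    by (auto simp: fun_eq_iff F12_def mem_X pairing 0)
qed

section \<open>The function space \<open>S'\<close>\<close>

lemma S'_outside: "f \<in> S' \<Longrightarrow> pairing v w \<noteq> 0 \<Longrightarrow> f (v, w) = 0"
  by (auto simp: S'_def mem_X)

text \<open>The restriction to points of \<open>X\<close> can be lifted: nonzero scalings of a point
  off \<open>X\<close> stay off \<open>X\<close>, where \<open>f\<close> vanishes.\<close>

lemma S'_sums:
  assumes "f \<in> S'"
  shows "(\<Sum>c\<in>UNIV - {0}. f (c *s v, w)) = 0" "(\<Sum>c\<in>UNIV - {0}. f (v, c *s w)) = 0"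
    "(\<Sum>c\<in>UNIV - {0}. f (c *s v, c *s w)) = 0"
proof -
  have "(\<Sum>c\<in>UNIV - {0}. f (c *s v, w)) = 0 \<and> (\<Sum>c\<in>UNIV - {0}. f (v, c *s w)) = 0 \<and>
    (\<Sum>c\<in>UNIV - {0}. f (c *s v, c *s w)) = 0"
  proof (cases "pairing v w = 0")
    case True
    with assms show ?thesis unfolding S'_def X_def by blast
  next
    case False
    then show ?thesis
      by (auto intro!: sum.neutral S'_outside[OF assms] simp: pairing_scale_left pairing_scale_right)
  qed
  then show "(\<Sum>c\<in>UNIV - {0}. f (c *s v, w)) = 0" "(\<Sum>c\<in>UNIV - {0}. f (v, c *s w)) = 0"
    "(\<Sum>c\<in>UNIV - {0}. f (c *s v, c *s w)) = 0"
    by simp_all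
qed

lemma S'_I:
  assumes "\<And>v w. pairing v w \<noteq> 0 \<Longrightarrow> f (v, w) = 0"
    and "\<And>v w. (\<Sum>c\<in>UNIV - {0}. f (c *s v, w)) = 0"
    and "\<And>v w. (\<Sum>c\<in>UNIV - {0}. f (v, c *s w)) = 0"
    and "\<And>v w. (\<Sum>c\<in>UNIV - {0}. f (c *s v, c *s w)) = 0"
  shows "f \<in> S'"
  using assms by (auto simp: S'_def mem_X)

text \<open>At a zero coordinate the scaling is trivial and the condition reads (q - 1) f = 0. This
  is consistent with the zero values assigned to \<open>F12\<close> and \<open>F23\<close>.\<close>

lemma S'_0:
  fixes f :: "'a::{field,finite} pt \<Rightarrow> complex"
  assumes "f \<in> S'"
  shows "f (0, w) = 0" "f (v, 0) = 0"
proof -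
  have "(UNIV - {0::'a}) \<noteq> {}" using one_neq_zero by blast
  then have "card (UNIV - {0::'a}) \<noteq> 0" by (metis card_eq_0_iff finite)
  moreover have "of_nat (card (UNIV - {0::'a})) * f (0, w) = 0"
    "of_nat (card (UNIV - {0::'a})) * f (v, 0) = 0"
    using S'_sums(1)[OF assms, of 0 w] S'_sums(2)[OF assms, of v 0] by simp_all
  ultimately show "f (0, w) = 0" "f (v, 0) = 0" by (simp_all del: card_Diff_insert of_nat_diff)
qed

lemma S'_linear:
  assumes "f \<in> S'" "h \<in> S'"
  shows "(\<lambda>x. a * f x + b * h x) \<in> S'"
  by (rule S'_I)
    (simp_all add: S'_outside[OF assms(1)] S'_outside[OF assms(2)]
      S'_sums[OF assms(1)] S'_sums[OF assms(2)] sum.distrib flip: sum_distrib_left)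

lemma S'_swap:
  assumes "f \<in> S'"
  shows "f \<circ> prod.swap \<in> S'"
  by (rule S'_I) (simp_all add: S'_outside[OF assms] S'_sums[OF assms] pairing_commute)

lemma S'_linear_maps:
  assumes "f \<in> S'"
    and "\<And>c v. \<alpha> (c *s v) = c *s \<alpha> v" "\<And>c w. \<beta> (c *s w) = c *s \<beta> w"
    and "\<And>v w. pairing v w \<noteq> 0 \<Longrightarrow> pairing (\<alpha> v) (\<beta> w) \<noteq> 0"
  shows "(\<lambda>(v, w). f (\<alpha> v, \<beta> w)) \<in> S'"
  by (rule S'_I) (simp_all add: assms S'_outside[OF assms(1)] S'_sums[OF assms(1)])

lemma S'_scale:
  assumes "f \<in> S'" "a \<noteq> 0" "b \<noteq> 0"
  shows "(\<lambda>(v, w). f (a *s v, b *s w)) \<in> S'"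
  by (rule S'_linear_maps[of f "(*s) a" "(*s) b"])
    (use assms in \<open>simp_all add: vector_smult_assoc pairing_scale_left pairing_scale_right mult.commute\<close>)

section \<open>Stability of \<open>S'\<close> under \<open>F12\<close>, and Fourier
  inversion\<close>

lemma sum_inverse:
  "(\<Sum>c\<in>UNIV - {0::'a::field}. g (inverse c)) = (\<Sum>c\<in>UNIV - {0}. g c)"
  by (rule sum.reindex_bij_witness[of _ inverse inverse]) auto

text \<open>By \<open>F12_scale\<close> the condition on scalings of \<open>v\<close> is preserved
  and the other two are interchanged, just as the reflection in alpha_1 - alpha_2 negates its own
  coroot and swaps the other two positive ones.\<close>

lemma F12_S':
  fixes \<psi> :: "'a::{field,finite} \<Rightarrow> complex"
  assumes "f \<in> S'"
  shows "F12 \<psi> f \<in> S'"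
proof (rule S'_I)
  fix v w :: "'a ^ 3"
  have "(\<Sum>c\<in>UNIV - {0}. F12 \<psi> f (c *s v, w)) =
      (\<Sum>c\<in>UNIV - {0}. F12 \<psi> (\<lambda>(v, w). f (inverse c *s v, w)) (v, w))"
    using F12_scale[of "inverse c" 1 \<psi> f v w for c]
    by (intro sum.cong) (simp_all add: divide_inverse)
  also have "\<dots> = F12 \<psi> (\<lambda>x. \<Sum>c\<in>UNIV - {0}. f (inverse c *s fst x, snd x)) (v, w)"
    by (simp add: F12_sum case_prod_unfold)
  also have "\<dots> = 0"
    by (simp add: sum_inverse[of "\<lambda>c. f (c *s _, _)"] S'_sums assms)
  finally show "(\<Sum>c\<in>UNIV - {0}. F12 \<psi> f (c *s v, w)) = 0" .
  have "(\<Sum>c\<in>UNIV - {0}. F12 \<psi> f (v, c *s w)) =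
      (\<Sum>c\<in>UNIV - {0}. F12 \<psi> (\<lambda>(v, w). f (c *s v, c *s w)) (v, w))"
    using F12_scale[of c c \<psi> f v w for c] by (intro sum.cong) simp_all
  also have "\<dots> = F12 \<psi> (\<lambda>x. \<Sum>c\<in>UNIV - {0}. f (c *s fst x, c *s snd x)) (v, w)"
    by (simp add: F12_sum case_prod_unfold)
  finally show "(\<Sum>c\<in>UNIV - {0}. F12 \<psi> f (v, c *s w)) = 0"
    by (simp add: S'_sums assms)
  have "(\<Sum>c\<in>UNIV - {0}. F12 \<psi> f (c *s v, c *s w)) =
      (\<Sum>c\<in>UNIV - {0}. F12 \<psi> (\<lambda>(v, w). f (v, c *s w)) (v, w))"
    using F12_scale[of 1 c \<psi> f v w for c] by (intro sum.cong) simp_all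
  also have "\<dots> = F12 \<psi> (\<lambda>x. \<Sum>c\<in>UNIV - {0}. f (fst x, c *s snd x)) (v, w)"
    by (simp add: F12_sum case_prod_unfold)
  finally show "(\<Sum>c\<in>UNIV - {0}. F12 \<psi> f (c *s v, c *s w)) = 0"
    by (simp add: S'_sums assms)
qed (rule F12_outside)

lemma cross_quot_swap:
  assumes "w \<noteq> 0" "pairing u w = 0" "pairing v w = 0"
  shows "cross_quot u v w = - cross_quot v u w"
  using assms cross_eq_cross_quot[of w v u]
  by (intro cross_quot_eqI) (simp_all add: cross_swap[of u v] vector_smult_lneg)

lemma cross_quot_diff_right:
  assumes "w \<noteq> 0" "pairing u w = 0" "pairing v w = 0" "pairing v' w = 0"
  shows "cross_quot u (v - v') w = cross_quot u v w - cross_quot u v' w"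
  using assms cross_eq_cross_quot[of w u v] cross_eq_cross_quot[of w u v']
  by (intro cross_quot_eqI) (simp_all add: cross_diff_right vector_ssub_ldistrib vector_sadd_rdistrib
      vec_eq_iff algebra_simps)

text \<open>The two phases combine to one that depends on \<open>v - x\<close>, and summing over the
  middle variable leaves q^2 at \<open>x = v\<close>, which cancels the two factors 1/q.
  Antisymmetry of the form is why \<open>f\<close> itself returns and not its reflection in
  \<open>v\<close>.\<close>

lemma F12_F12:
  fixes \<psi> :: "'a::{field,finite} \<Rightarrow> complex"
  assumes \<psi>: "nontrivial_additive_character \<psi>" and f: "f \<in> S'"
  shows "F12 \<psi> (F12 \<psi> f) = f"
proof
  fix p :: "'a pt"
  obtain v w where p: "p = (v, w)" by fastforce
  let ?q = "of_nat CARD('a) :: complex"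
  show "F12 \<psi> (F12 \<psi> f) p = f p"
  proof (cases "pairing v w = 0 \<and> w \<noteq> 0")
    case False
    \<comment> \<open>Here \<open>f\<close> vanishes, either off \<open>X\<close> or by
      \<open>S'_0\<close>, in agreement with the default value of \<open>F12\<close>.\<close>
    then show ?thesis using f by (auto simp: p F12_outside S'_outside S'_0)
  next
    case True
    then have w: "w \<noteq> 0" and v: "pairing v w = 0" by auto
    have *: "\<psi> (cross_quot x u w) * \<psi> (cross_quot u v w) = \<psi> (cross_quot u (v - x) w)"
      if "pairing x w = 0" "pairing u w = 0" for x u
      using that w v
      by (simp add: cross_quot_diff_right cross_quot_swap[of w x u] flip: char_add[OF \<psi>])
    have "F12 \<psi> (F12 \<psi> f) p =
        (\<Sum>u | pairing u w = 0. (\<Sum>x | pairing x w = 0. f (x, w) * \<psi> (cross_quot x u w)) / ?q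
           * \<psi> (cross_quot u v w)) / ?q"
      using w v by (simp add: p F12_apply)
    also have "\<dots> = (\<Sum>u | pairing u w = 0. \<Sum>x | pairing x w = 0.
        f (x, w) * (\<psi> (cross_quot x u w) * \<psi> (cross_quot u v w))) / ?q ^ 2"
      by (simp add: sum_divide_distrib sum_distrib_right power2_eq_square mult.assoc)
    also have "\<dots> = (\<Sum>u | pairing u w = 0. \<Sum>x | pairing x w = 0.
        f (x, w) * \<psi> (cross_quot u (v - x) w)) / ?q ^ 2"
      by (simp add: *)
    also have "\<dots> = (\<Sum>x | pairing x w = 0. f (x, w) *
        (\<Sum>u | pairing u w = 0. \<psi> (cross_quot u (v - x) w))) / ?q ^ 2"
      unfolding sum_distrib_left by (subst sum.swap) (rule refl)
    also have "\<dots> = (\<Sum>x | pairing x w = 0. if x = v then f (x, w) * ?q ^ 2 else 0) / ?q ^ 2"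
      using w v by (intro arg_cong2[where f = "(/)"] sum.cong refl)
        (simp_all add: sum_char_symplectic[OF \<psi>] pairing_diff_left)
    also have "\<dots> = f p"
      using v by (simp add: p sum.delta)
    finally show ?thesis .
  qed
qed

section \<open>The second transform, by duality\<close>

lemma F23_apply:
  "pairing v w = 0 \<Longrightarrow> v \<noteq> 0 \<Longrightarrow>
   F23 \<psi> f (v, w) = (\<Sum>y | pairing v y = 0. f (v, y) * \<psi> (cross_quot y w v)) / of_nat CARD('a)"
  for \<psi> :: "'a::{field,finite} \<Rightarrow> complex"
  by (simp add: F23_def mem_X)

text \<open>The two formulas are mirror images under the exchange of V and its dual; the facts on
  \<open>F23\<close> below are inherited from \<open>F12\<close> through this conjugation.\<close>

lemma F23_swap: "F23 \<psi> f = F12 \<psi> (f \<circ> prod.swap) \<circ> prod.swap"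
  by (auto simp: F23_def F12_def fun_eq_iff mem_X pairing_commute)

lemma F23_S': "f \<in> S' \<Longrightarrow> F23 \<psi> f \<in> S'"
  unfolding F23_swap by (intro S'_swap F12_S')

lemma F23_F23: "nontrivial_additive_character \<psi> \<Longrightarrow> f \<in> S' \<Longrightarrow> F23 \<psi> (F23 \<psi> f) = f"
  by (simp add: F23_swap comp_assoc swap_comp_swap F12_F12 S'_swap)

lemma F23_linear:
  "F23 \<psi> (\<lambda>x. a * f x + b * h x) = (\<lambda>x. a * F23 \<psi> f x + b * F23 \<psi> h x)"
  using F12_linear[of \<psi> a "f \<circ> prod.swap" b "h \<circ> prod.swap"]
  by (simp add: F23_swap comp_def fun_eq_iff)

lemma F23_scale:
  assumes "a \<noteq> 0" "b \<noteq> 0"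
  shows "F23 \<psi> (\<lambda>(v, w). f (a *s v, b *s w)) (v, w) = F23 \<psi> f (a *s v, (a / b) *s w)"
  using F12_scale[OF assms(2,1), of \<psi> "f \<circ> prod.swap" w v]
  by (simp add: F23_swap comp_def case_prod_unfold)

subsection \<open>The braid relation\<close>

text \<open>The three phases belong to the path from (x, y) through (u, y) and (u, w) to (v, w). The
  case split is on whether \<open>y\<close> and \<open>w\<close> are independent.\<close>

lemma kernel_sum:
  fixes v w x y :: "'a::{field,finite} ^ 3"
  assumes \<psi>: "nontrivial_additive_character \<psi>"
    and w: "w \<noteq> 0" and y: "y \<noteq> 0" and v: "pairing v w = 0" and x: "pairing x y = 0"
  shows "(\<Sum>u | u \<noteq> 0 \<and> pairing u w = 0 \<and> pairing u y = 0.
      \<psi> (cross_quot x u y) * \<psi> (cross_quot y w u) * \<psi> (cross_quot u v w)) =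
    Kl \<psi> (pairing x w + pairing v y) +
    (if \<exists>c. c \<noteq> 0 \<and> x = c *s v \<and> y = c *s w then of_nat CARD('a) ^ 2 else 0)"
    (is "(\<Sum>u\<in>?U. ?g u) = _")
proof (cases "cross y w = 0")
  case False
  have no: "\<not> (\<exists>c. c \<noteq> 0 \<and> x = c *s v \<and> y = c *s w)"
  proof
    assume "\<exists>c. c \<noteq> 0 \<and> x = c *s v \<and> y = c *s w"
    then have "cross y w = 0"
      by (auto simp: vec_eq_iff forall_3 cross_components)
    with False show False by simp
  qed
  let ?n = "cross y w"
  \<comment> \<open>The vectors orthogonal to both \<open>y\<close> and \<open>w\<close> form the
    line through y x w, so \<open>t = cross_quot y w u\<close> is a coordinate on its nonzero
    points.\<close>
  have U: "cross_quot y w u \<noteq> 0 \<and> inverse (cross_quot y w u) *s ?n = u" if "u \<in> ?U" for u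
  proof -
    have n: "?n = cross_quot y w u *s u"
      using that by (intro cross_eq_cross_quot) (simp_all add: pairing_commute)
    moreover have "cross_quot y w u \<noteq> 0"
    proof
      assume "cross_quot y w u = 0"
      with n False show False by simp
    qed
    ultimately show ?thesis
      by (simp add: vector_smult_assoc)
  qed
  have t: "inverse t *s ?n \<in> ?U" "cross_quot y w (inverse t *s ?n) = t"
    "?g (inverse t *s ?n) = \<psi> ((pairing x w + pairing v y) / t + t)" if "t \<noteq> 0" for t
  proof -
    have nz: "inverse t *s ?n \<noteq> 0"
      using that False by simp
    then show "inverse t *s ?n \<in> ?U"
      by (simp add: pairing_scale_left pairing_cross_left pairing_cross_right)
    show 1: "cross_quot y w (inverse t *s ?n) = t"
      using nz that by (intro cross_quot_eqI) (simp_all add: vector_smult_assoc)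
    \<comment> \<open>Since x . y = 0, the triple product x x (y x w) is (x . w) y; likewise v . w =
      0 gives (y x w) x v = (v . y) w below.\<close>
    have 2: "cross_quot x (inverse t *s ?n) y = pairing x w / t"
      using y x by (intro cross_quot_eqI)
        (simp_all add: cross_scale_right cross_cross vector_smult_assoc divide_inverse mult.commute)
    have 3: "cross_quot (inverse t *s ?n) v w = pairing v y / t"
      using w v by (intro cross_quot_eqI)
        (simp_all add: cross_scale_left cross_swap[of ?n] cross_cross vector_smult_assoc
          divide_inverse mult.commute)
    show "?g (inverse t *s ?n) = \<psi> ((pairing x w + pairing v y) / t + t)"
      unfolding 1 2 3 by (simp add: char_add[OF \<psi>] add_divide_distrib)
  qed
  have "(\<Sum>u\<in>?U. ?g u) = Kl \<psi> (pairing x w + pairing v y)"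
    unfolding Kl_def
  proof (rule sum.reindex_bij_witness[of _ "\<lambda>t. inverse t *s ?n" "cross_quot y w"])
    fix u assume u: "u \<in> ?U"
    show "inverse (cross_quot y w u) *s ?n = u" "cross_quot y w u \<in> UNIV - {0}"
      using U[OF u] by auto
    show "\<psi> ((pairing x w + pairing v y) / cross_quot y w u + cross_quot y w u) = ?g u"
      using t(3)[of "cross_quot y w u"] U[OF u] by simp
  qed (use t in auto)
  with no show ?thesis by simp
next
  case True
  then have "cross w y = 0" by (simp add: cross_swap[of w])
  then obtain c where yc: "y = c *s w"
    using parallel_if_cross_eq_0 w by blast
  with y have c: "c \<noteq> 0" by auto
  have x': "pairing x w = 0"
    using x c by (simp add: yc pairing_scale_right)
  \<comment> \<open>With \<open>y = c *s w\<close> the middle phase is 1, and antisymmetry merges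
    the outer two into a single character of the plane with parameter \<open>d\<close>.\<close>
  define d where "d = v - inverse c *s x"
  have d: "pairing d w = 0"
    using v x' by (simp add: d_def pairing_diff_left pairing_scale_left)
  have g: "?g u = \<psi> (cross_quot u d w)" if "u \<noteq> 0" "pairing u w = 0" for u
  proof -
    have 1: "cross_quot y w u = 0"
      using that True by (intro cross_quot_eqI) simp_all
    have "cross_quot x u y = cross_quot (inverse c *s x) u w"
      using c by (intro cross_quot_cong)
        (auto simp: yc cross_scale_left vec_eq_iff forall_3 field_simps)
    also have "\<dots> = - cross_quot u (inverse c *s x) w"
      using that w x' by (intro cross_quot_swap) (simp_all add: pairing_scale_left)
    finally have 2: "cross_quot x u y = - cross_quot u (inverse c *s x) w" .
    show ?thesis
      unfolding 1 2 d_def using that w v x'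
      by (simp add: cross_quot_diff_right pairing_scale_left char_0[OF \<psi>] flip: char_add[OF \<psi>])
  qed
  have "?U = {u. pairing u w = 0} - {0}"
    by (auto simp: yc pairing_scale_right)
  then have "(\<Sum>u\<in>?U. ?g u) = (\<Sum>u\<in>{u. pairing u w = 0} - {0}. \<psi> (cross_quot u d w))"
    using g by (intro sum.cong) auto
  \<comment> \<open>The excluded term \<open>u = 0\<close> contributes 1, and the resulting -1 is
    the Kloosterman value at 0.\<close>
  also have "\<dots> = (\<Sum>u | pairing u w = 0. \<psi> (cross_quot u d w)) - \<psi> (cross_quot 0 d w)"
    by (simp add: sum_diff1)
  also have "cross_quot 0 d w = 0"
    using w by (intro cross_quot_eqI) (simp_all add: cross_swap[of 0])
  finally have "(\<Sum>u\<in>?U. ?g u) = (if d = 0 then of_nat CARD('a) ^ 2 else 0) - 1"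
    by (simp add: sum_char_symplectic[OF \<psi> w d] char_0[OF \<psi>])
  moreover have "d = 0 \<longleftrightarrow> (\<exists>c. c \<noteq> 0 \<and> x = c *s v \<and> y = c *s w)"
  proof
    assume "d = 0"
    then have "x = c *s v" using c by (simp add: d_def vector_smult_assoc)
    with c yc show "\<exists>c. c \<noteq> 0 \<and> x = c *s v \<and> y = c *s w" by blast
  next
    assume "\<exists>c. c \<noteq> 0 \<and> x = c *s v \<and> y = c *s w"
    then have "x = c *s v"
      using yc w by (auto simp: scale_right_cancel)
    then show "d = 0" using c by (simp add: d_def vector_smult_assoc)
  qed
  moreover have "pairing x w + pairing v y = 0"
    using x' v by (simp add: yc pairing_scale_right)
  ultimately show ?thesis by (simp add: Kl_0[OF \<psi>])
qed

lemma sum_X: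
  "(\<Sum>(x, y)\<in>X. g x y) = (\<Sum>y\<in>UNIV. \<Sum>x | pairing x y = 0. g x y)"
  for g :: "'a::{field,finite} ^ 3 \<Rightarrow> 'a ^ 3 \<Rightarrow> complex"
  by (subst sum.Sigma, simp, simp,
    rule sum.reindex_bij_witness[of _ prod.swap prod.swap]) (auto simp: mem_X)

text \<open>For \<open>y \<noteq> 0\<close> the sum is q times \<open>F12 \<psi> f (0, y)\<close>,
  whose phase is trivial, and \<open>F12 \<psi> f\<close> lies in \<open>S'\<close>, hence vanishes
  at a zero coordinate.\<close>

lemma sum_perp:
  fixes f :: "'a::{field,finite} pt \<Rightarrow> complex"
  assumes \<psi>: "nontrivial_additive_character (\<psi> :: 'a \<Rightarrow> complex)" and f: "f \<in> S'"
  shows "(\<Sum>x | pairing x y = 0. f (x, y)) = 0"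
proof (cases "y = 0")
  case True
  then show ?thesis by (simp add: S'_0(2)[OF f])
next
  case False
  have "cross_quot u 0 y = 0" for u
    using False by (intro cross_quot_eqI) simp_all
  then show ?thesis
    using S'_0(1)[OF F12_S'[OF f, of \<psi>], of y] False by (simp add: F12_apply char_0[OF \<psi>])
qed

text \<open>For \<open>w = 0\<close> the Kloosterman argument is independent of the first summation
  variable, so \<open>sum_perp\<close> kills each inner sum.\<close>

lemma Fw0_0_right:
  assumes \<psi>: "nontrivial_additive_character \<psi>" and f: "f \<in> S'"
  shows "Fw0 \<psi> f (v, 0) = 0"
  by (simp add: Fw0_def mem_X sum_X sum_perp[OF \<psi> f] flip: sum_distrib_right)

lemma Fw0_swap: "Fw0 \<psi> (f \<circ> prod.swap) \<circ> prod.swap = Fw0 \<psi> f"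
proof -
  have "(\<Sum>(x, y)\<in>X. f (y, x) * Kl \<psi> (pairing x v + pairing w y)) =
    (\<Sum>(x, y)\<in>X. f (x, y) * Kl \<psi> (pairing x w + pairing v y))" for v w
    by (rule sum.reindex_bij_witness[of _ prod.swap prod.swap])
      (auto simp: mem_X pairing_commute add.commute)
  then show ?thesis by (auto simp: Fw0_def mem_X fun_eq_iff pairing_commute)
qed

lemma F12_F23_F12:
  fixes \<psi> :: "'a::{field,finite} \<Rightarrow> complex"
  assumes \<psi>: "nontrivial_additive_character \<psi>" and f: "f \<in> S'"
  shows "F12 \<psi> (F23 \<psi> (F12 \<psi> f)) = Fw0 \<psi> f"
proof
  fix p :: "'a pt"
  obtain v w where p: "p = (v, w)" by fastforce
  let ?q = "of_nat CARD('a) :: complex"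
  show "F12 \<psi> (F23 \<psi> (F12 \<psi> f)) p = Fw0 \<psi> f p"
  proof (cases "pairing v w = 0 \<and> w \<noteq> 0")
    case False
    \<comment> \<open>At \<open>w = 0\<close> the left side is zero by convention, while the right
      side needs \<open>Fw0_0_right\<close>.\<close>
    then show ?thesis
      by (auto simp: p F12_outside Fw0_def mem_X Fw0_0_right[OF \<psi> f, unfolded Fw0_def mem_X, simplified])
  next
    case True
    then have w: "w \<noteq> 0" and v: "pairing v w = 0" by auto
    define U where "U = {u. u \<noteq> 0 \<and> pairing u w = 0}"
    define Y where "Y = {y :: 'a ^ 3. y \<noteq> 0}"
    define g where "g = (\<lambda>x y u. \<psi> (cross_quot x u y) * \<psi> (cross_quot y w u) * \<psi> (cross_quot u v w))"
    define P where "P = (SIGMA y:Y. {x. pairing x y = 0})"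
    \<comment> \<open>The punctured line through (v, w), in the order (y, x) of \<open>P\<close>:
      the support of the q^2 excess in \<open>kernel_sum\<close>.\<close>
    define I where "I = (\<lambda>c. (c *s w, c *s v)) ` (UNIV - {0})"
    have "F12 \<psi> (F23 \<psi> (F12 \<psi> f)) p =
        (\<Sum>u | pairing u w = 0. F23 \<psi> (F12 \<psi> f) (u, w) * \<psi> (cross_quot u v w)) / ?q"
      using w v by (simp add: p F12_apply)
    \<comment> \<open>The convention for \<open>F23\<close> at \<open>u = 0\<close> removes that
      term, which is why \<open>kernel_sum\<close> runs over nonzero \<open>u\<close>. The one for
      \<open>F12\<close> removes \<open>y = 0\<close> in the same way below.\<close>
    also have "(\<Sum>u | pairing u w = 0. F23 \<psi> (F12 \<psi> f) (u, w) * \<psi> (cross_quot u v w)) =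
        (\<Sum>u\<in>U. F23 \<psi> (F12 \<psi> f) (u, w) * \<psi> (cross_quot u v w))"
      by (rule sum.mono_neutral_right) (auto simp: U_def F23_def)
    also have "\<dots> = (\<Sum>u\<in>U. \<Sum>y\<in>{y\<in>Y. pairing u y = 0}. \<Sum>x | pairing x y = 0.
        f (x, y) * g x y u) / ?q ^ 2"
      unfolding sum_divide_distrib
    proof (rule sum.cong[OF refl])
      fix u assume u: "u \<in> U"
      have "F23 \<psi> (F12 \<psi> f) (u, w) =
          (\<Sum>y | pairing u y = 0. F12 \<psi> f (u, y) * \<psi> (cross_quot y w u)) / ?q"
        using u by (simp add: F23_apply U_def)
      also have "(\<Sum>y | pairing u y = 0. F12 \<psi> f (u, y) * \<psi> (cross_quot y w u)) =
          (\<Sum>y\<in>{y\<in>Y. pairing u y = 0}. F12 \<psi> f (u, y) * \<psi> (cross_quot y w u))"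
        by (rule sum.mono_neutral_right) (auto simp: Y_def)
      also have "\<dots> = (\<Sum>y\<in>{y\<in>Y. pairing u y = 0}.
          (\<Sum>x | pairing x y = 0. f (x, y) * \<psi> (cross_quot x u y)) / ?q * \<psi> (cross_quot y w u))"
        by (rule sum.cong) (auto simp: Y_def F12_apply)
      finally show "F23 \<psi> (F12 \<psi> f) (u, w) * \<psi> (cross_quot u v w) =
          (\<Sum>y\<in>{y\<in>Y. pairing u y = 0}. \<Sum>x | pairing x y = 0. f (x, y) * g x y u / ?q ^ 2)"
        by (simp add: g_def sum_divide_distrib sum_distrib_right power2_eq_square mult.assoc)
    qed
    also have "(\<Sum>u\<in>U. \<Sum>y\<in>{y\<in>Y. pairing u y = 0}. \<Sum>x | pairing x y = 0. f (x, y) * g x y u) =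
        (\<Sum>y\<in>Y. \<Sum>u\<in>{u\<in>U. pairing u y = 0}. \<Sum>x | pairing x y = 0. f (x, y) * g x y u)"
      by (rule sum.swap_restrict) simp_all
    also have "\<dots> = (\<Sum>y\<in>Y. \<Sum>x | pairing x y = 0. f (x, y) * (\<Sum>u\<in>{u\<in>U. pairing u y = 0}. g x y u))"
      unfolding sum_distrib_left by (rule sum.cong[OF refl], rule sum.swap)
    also have "\<dots> = (\<Sum>y\<in>Y. \<Sum>x | pairing x y = 0. f (x, y) * (Kl \<psi> (pairing x w + pairing v y) +
        (if (y, x) \<in> I then ?q ^ 2 else 0)))"
    proof (intro sum.cong refl arg_cong2[where f = "(*)"])
      fix y x assume "y \<in> Y" "x \<in> {x. pairing x y = 0}"
      then have "(\<Sum>u | u \<noteq> 0 \<and> pairing u w = 0 \<and> pairing u y = 0. g x y u) =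
          Kl \<psi> (pairing x w + pairing v y) +
          (if \<exists>c. c \<noteq> 0 \<and> x = c *s v \<and> y = c *s w then ?q ^ 2 else 0)"
        unfolding g_def using w v by (intro kernel_sum[OF \<psi>]) (simp_all add: Y_def)
      moreover have "(\<exists>c. c \<noteq> 0 \<and> x = c *s v \<and> y = c *s w) \<longleftrightarrow> (y, x) \<in> I"
        by (auto simp: I_def)
      moreover have "{u\<in>U. pairing u y = 0} = {u. u \<noteq> 0 \<and> pairing u w = 0 \<and> pairing u y = 0}"
        by (auto simp: U_def)
      ultimately show "(\<Sum>u\<in>{u\<in>U. pairing u y = 0}. g x y u) =
          Kl \<psi> (pairing x w + pairing v y) + (if (y, x) \<in> I then ?q ^ 2 else 0)"
        by simp
    qed
    also have "\<dots> = (\<Sum>y\<in>Y. \<Sum>x | pairing x y = 0. f (x, y) * Kl \<psi> (pairing x w + pairing v y)) +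
        (\<Sum>y\<in>Y. \<Sum>x | pairing x y = 0. if (y, x) \<in> I then f (x, y) * ?q ^ 2 else 0)"
      unfolding sum.distrib[symmetric] by (intro sum.cong refl) (simp add: distrib_left)
    also have "(\<Sum>y\<in>Y. \<Sum>x | pairing x y = 0. if (y, x) \<in> I then f (x, y) * ?q ^ 2 else 0) =
        (\<Sum>(y, x)\<in>P. if (y, x) \<in> I then f (x, y) * ?q ^ 2 else 0)"
      unfolding P_def by (rule sum.Sigma) simp_all
    also have "\<dots> = (\<Sum>(y, x)\<in>I. f (x, y) * ?q ^ 2)"
    proof (rule sum.mono_neutral_cong_right)
      show "I \<subseteq> P"
        using w v by (auto simp: I_def P_def Y_def pairing_scale_left pairing_scale_right)
    qed auto
    \<comment> \<open>As \<open>w \<noteq> 0\<close>, distinct \<open>c\<close> give distinct points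
      of \<open>I\<close>, so the excess is a sum over simultaneous scalings, the third condition of
      \<open>S'\<close>.\<close>
    also have "\<dots> = (\<Sum>c\<in>UNIV - {0}. f (c *s v, c *s w)) * ?q ^ 2"
      unfolding I_def using w
      by (subst sum.reindex) (auto simp: inj_on_def scale_right_cancel sum_distrib_right)
    also have "(\<Sum>c\<in>UNIV - {0}. f (c *s v, c *s w)) = 0"
      by (rule S'_sums(3)[OF f])
    \<comment> \<open>The terms with \<open>y = 0\<close> can be restored because
      \<open>f (x, 0) = 0\<close>, which turns the sum into one over all of
      \<open>X\<close>.\<close>
    also have "(\<Sum>y\<in>Y. \<Sum>x | pairing x y = 0. f (x, y) * Kl \<psi> (pairing x w + pairing v y)) =
        (\<Sum>y\<in>UNIV. \<Sum>x | pairing x y = 0. f (x, y) * Kl \<psi> (pairing x w + pairing v y))"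
      by (rule sum.mono_neutral_left) (auto simp: Y_def S'_0(2)[OF f])
    finally show ?thesis
      using v by (simp add: p Fw0_def mem_X sum_X power3_eq_cube power2_eq_square)
  qed
qed

lemma F23_F12_F23:
  assumes "nontrivial_additive_character \<psi>" and "f \<in> S'"
  shows "F23 \<psi> (F12 \<psi> (F23 \<psi> f)) = Fw0 \<psi> f"
proof -
  have "F23 \<psi> (F12 \<psi> (F23 \<psi> f)) = F12 \<psi> (F23 \<psi> (F12 \<psi> (f \<circ> prod.swap))) \<circ> prod.swap"
    by (simp add: F23_swap comp_assoc)
  with assms show ?thesis by (simp add: F12_F23_F12 S'_swap Fw0_swap)
qed

subsection \<open>Equivariance\<close>

lemma L_eq: "L g f = (\<lambda>(v, w). f (matrix_inv g *v v, w v* matrix_inv (matrix_inv g)))"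
  by (auto simp: L_def actG_def fun_eq_iff)

text \<open>A matrix of determinant 1 together with its contragredient preserves the pairing and
  both cross products. The list is symmetric in V and its dual, to serve \<open>F12_L\<close> and
  \<open>F23_L\<close> alike.\<close>

lemma SL3_dual_maps:
  assumes "det h = 1"
  defines "\<alpha> \<equiv> (*v) h" and "\<beta> \<equiv> (\<lambda>w. w v* matrix_inv h)"
  shows "bij \<alpha>" "bij \<beta>" "\<alpha> (c *s v) = c *s \<alpha> v" "\<beta> (c *s w) = c *s \<beta> w"
    "pairing (\<alpha> v) (\<beta> w) = pairing v w"
    "cross (\<alpha> v) (\<alpha> v') = \<beta> (cross v v')" "cross (\<beta> w) (\<beta> w') = \<alpha> (cross w w')"
proof -
  note h = det_1_matrix_inv[OF assms(1)]
  show "bij \<alpha>" unfolding \<alpha>_def using assms(1) by (intro bij_matrix_vector_mult) simp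
  show "bij \<beta>" unfolding \<beta>_def
    by (rule bij_betw_byWitness[where f' = "\<lambda>w. w v* h"]) (simp_all add: vector_matrix_mul_assoc h)
  show "\<alpha> (c *s v) = c *s \<alpha> v"
    by (simp add: \<alpha>_def vector_scalar_commute)
  show "\<beta> (c *s w) = c *s \<beta> w"
    by (simp add: \<beta>_def vector_matrix_mult_scale)
  show "pairing (\<alpha> v) (\<beta> w) = pairing v w"
    by (simp add: \<alpha>_def \<beta>_def pairing_matrix vector_matrix_mul_assoc h)
  have "cross (h *v v) (h *v v') = (cross (h *v v) (h *v v') v* h) v* matrix_inv h"
    by (simp add: vector_matrix_mul_assoc h)
  then show "cross (\<alpha> v) (\<alpha> v') = \<beta> (cross v v')"
    by (simp add: \<alpha>_def \<beta>_def cross_matrix_vector_mult assms(1))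
  have "cross (w v* matrix_inv h) (w' v* matrix_inv h) =
      h *v (matrix_inv h *v cross (w v* matrix_inv h) (w' v* matrix_inv h))"
    by (simp add: matrix_vector_mul_assoc h)
  then show "cross (\<beta> w) (\<beta> w') = \<alpha> (cross w w')"
    by (simp add: \<alpha>_def \<beta>_def cross_vector_matrix_mult h)
qed

lemma SL3_matrix_inv: "g \<in> SL3 \<Longrightarrow> det (matrix_inv g) = 1"
  by (simp add: SL3_def det_1_matrix_inv)

lemma L_S':
  assumes "g \<in> SL3" "f \<in> S'"
  shows "L g f \<in> S'"
  unfolding L_eq
  by (rule S'_linear_maps[OF assms(2)])
    (simp_all add: SL3_dual_maps[OF SL3_matrix_inv[OF assms(1)]])

lemma F12_L:
  assumes "g \<in> SL3"
  shows "F12 \<psi> (L g f) = L g (F12 \<psi> f)"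
  unfolding L_eq
  by (rule F12_equivariant)
    (simp_all add: SL3_dual_maps[OF SL3_matrix_inv[OF assms]] bij_is_inj)

lemma F23_L:
  assumes "g \<in> SL3"
  shows "F23 \<psi> (L g f) = L g (F23 \<psi> f)"
proof -
  let ?h = "matrix_inv g"
  have dual: "pairing (w v* matrix_inv ?h) (?h *v v) = pairing w v" for v w
    using SL3_dual_maps(5)[OF SL3_matrix_inv[OF assms], of v w] by (simp add: pairing_commute)
  \<comment> \<open>The same equivariance lemma, with the row action as \<open>\<alpha>\<close> and
    the column action as \<open>\<beta>\<close>.\<close>
  have "F12 \<psi> (\<lambda>(w, v). (f \<circ> prod.swap) (w v* matrix_inv ?h, ?h *v v)) =
      (\<lambda>(w, v). F12 \<psi> (f \<circ> prod.swap) (w v* matrix_inv ?h, ?h *v v))"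
    by (rule F12_equivariant)
      (simp_all add: SL3_dual_maps[OF SL3_matrix_inv[OF assms]] bij_is_inj dual)
  then show ?thesis
    by (simp add: L_eq F23_swap comp_def case_prod_unfold fun_eq_iff)
qed

section \<open>The torus action and products of permutations\<close>

lemma numeral_3_distinct: "(1::3) \<noteq> 2" "(1::3) \<noteq> 3" "(2::3) \<noteq> 3" "(2::3) \<noteq> 1" "(3::3) \<noteq> 1" "(3::3) \<noteq> 2"
  by simp_all

lemma T_iff: "t \<in> T \<longleftrightarrow> t$1$1 * t$2$2 * t$3$3 = 1 \<and> (\<forall>i j. i \<noteq> j \<longrightarrow> t $ i $ j = 0)"
proof (cases "\<forall>i j. i \<noteq> j \<longrightarrow> t $ i $ j = 0")
  case True
  then have "det t = t$1$1 * t$2$2 * t$3$3"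
    using numeral_3_distinct by (simp add: det_3)
  with True show ?thesis by (simp add: T_def SL3_def)
qed (auto simp: T_def)

lemma T_prod: "t \<in> T \<Longrightarrow> t$1$1 * t$2$2 * t$3$3 = 1"
  by (simp add: T_iff)

lemma R_eq: "R t f = (\<lambda>(v, w). f (t$1$1 *s v, inverse (t$3$3) *s w))"
  by (auto simp: R_def actT_def)

lemma T_nonzero:
  assumes "t \<in> T"
  shows "t$1$1 \<noteq> 0" "t$2$2 \<noteq> 0" "t$3$3 \<noteq> 0"
  using T_prod[OF assms] by auto

lemma R_S':
  assumes "t \<in> T" "f \<in> S'"
  shows "R t f \<in> S'"
  unfolding R_eq using assms T_nonzero[OF assms(1)] by (intro S'_scale) simp_all

lemma S3_values:
  "s12 1 = 2" "s12 2 = 1" "s12 3 = 3" "s23 1 = 1" "s23 2 = 3" "s23 3 = 2"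
  "w0 1 = 3" "w0 2 = 2" "w0 3 = 1"
  by (simp_all add: s12_def s23_def w0_def Transposition.transpose_def)

text \<open>The products of a simple reflection with a reduced word in which a cancellation or the
  longest element occurs.\<close>

lemma S3_table:
  "s12 \<circ> s12 = id" "s23 \<circ> s23 = id"
  "s12 \<circ> (s12 \<circ> s23) = s23" "s23 \<circ> (s23 \<circ> s12) = s12"
  "s12 \<circ> (s23 \<circ> s12) = w0" "s23 \<circ> (s12 \<circ> s23) = w0"
  "s12 \<circ> w0 = s23 \<circ> s12" "s23 \<circ> w0 = s12 \<circ> s23"
  by (simp_all add: fun_eq_iff forall_3 S3_values)

lemma bij_s12: "bij s12" and bij_s23: "bij s23"
  by (simp_all add: s12_def s23_def)

lemma inv_s12: "inv_into UNIV s12 = s12" and inv_s23: "inv_into UNIV s23 = s23"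
  using S3_table(1,2) by (auto intro!: inv_unique_comp)

subsection \<open>The symmetric group\<close>

lemma S3_cases:
  assumes "bij w"
  obtains "w = id" | "w = s12" | "w = s23" | "w = s12 \<circ> s23" | "w = s23 \<circ> s12" | "w = w0"
proof -
  have "w 1 \<noteq> w 2" "w 1 \<noteq> w 3" "w 2 \<noteq> w 3"
    by (simp_all only: inj_eq[OF bij_is_inj[OF assms]] numeral_3_distinct not_False_eq_True)
  then have "w = id \<or> w = s12 \<or> w = s23 \<or> w = s12 \<circ> s23 \<or> w = s23 \<circ> s12 \<or> w = w0"
    unfolding fun_eq_iff forall_3
    using exhaust_3[of "w 1"] exhaust_3[of "w 2"] exhaust_3[of "w 3"]
    by (elim disjE) (simp_all add: S3_values numeral_3_distinct)
  then show thesis using that by blast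
qed

text \<open>The simple reflections generate, so a property stable under left multiplication by them
  spreads from \<open>id\<close>. Linearity and both equivariances of the action are proved this
  way.\<close>

lemma S3_induct [consumes 1, case_names id s12 s23]:
  assumes "bij w" and "P id"
    and s12: "\<And>w. bij w \<Longrightarrow> P w \<Longrightarrow> P (s12 \<circ> w)"
    and s23: "\<And>w. bij w \<Longrightarrow> P w \<Longrightarrow> P (s23 \<circ> w)"
  shows "P w"
proof -
  have 1: "P s12" "P s23"
    using s12[of id] s23[of id] \<open>P id\<close> by simp_all
  have 2: "P (s12 \<circ> s23)" "P (s23 \<circ> s12)"
    using 1 by (auto intro: s12 s23 bij_s12 bij_s23)
  have "P (s12 \<circ> (s23 \<circ> s12))"
    by (intro s12 2 bij_comp bij_s12 bij_s23)
  with 1 2 \<open>P id\<close> show ?thesis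
    using S3_cases[OF \<open>bij w\<close>] by (metis S3_table(5))
qed

lemma permT_components: "permT w t $ i $ j = t $ inv_into UNIV w i $ inv_into UNIV w j"
  by (simp add: permT_def)

lemma permT_id: "permT id t = t"
  by (simp add: vec_eq_iff permT_components)

lemma permT_comp: "bij s \<Longrightarrow> bij w \<Longrightarrow> permT (s \<circ> w) t = permT s (permT w t)"
  by (simp add: vec_eq_iff permT_components o_inv_distrib)

lemma permT_s12_T: "t \<in> T \<Longrightarrow> permT s12 t \<in> T"
  and permT_s23_T: "t \<in> T \<Longrightarrow> permT s23 t \<in> T"
  using bij_s12 bij_s23
  by (auto simp: T_iff permT_components inv_s12 inv_s23 S3_values mult_ac bij_is_inj inj_eq)

lemma permT_T: "bij w \<Longrightarrow> t \<in> T \<Longrightarrow> permT w t \<in> T"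
  by (induction rule: S3_induct)
    (simp_all add: permT_id permT_comp bij_s12 bij_s23 permT_s12_T permT_s23_T)

section \<open>Torus equivariance of the two transforms\<close>

lemma F12_R:
  assumes "t \<in> T"
  shows "F12 \<psi> (R t f) = R (permT s12 t) (F12 \<psi> f)"
proof -
  \<comment> \<open>The factor \<open>b / a\<close> in \<open>F12_scale\<close> is 1/(t_1 t_3),
    which is t_2 because the determinant is 1: the first two diagonal entries trade places.\<close>
  have "inverse (t$3$3) / t$1$1 = t$2$2"
    using T_prod[OF assms] T_nonzero[OF assms] by (simp add: field_simps)
  then show ?thesis
    using F12_scale[of "t$1$1" "inverse (t$3$3)" \<psi> f] T_nonzero[OF assms]
    by (auto simp: fun_eq_iff R_eq permT_components inv_s12 S3_values)
qed

lemma F23_R: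
  assumes "t \<in> T"
  shows "F23 \<psi> (R t f) = R (permT s23 t) (F23 \<psi> f)"
proof -
  \<comment> \<open>Determinant 1 again: the new factor on \<open>w\<close> is the inverse of t_2,
    so the last two diagonal entries trade places.\<close>
  have "t$1$1 / inverse (t$3$3) = inverse (t$2$2)"
    using T_prod[OF assms] T_nonzero[OF assms] by (simp add: field_simps)
  then show ?thesis
    using F23_scale[of "t$1$1" "inverse (t$3$3)" \<psi> f] T_nonzero[OF assms]
    by (auto simp: fun_eq_iff R_eq permT_components inv_s23 S3_values)
qed

text \<open>A permutation of \<open>1\<close>, \<open>2\<close>, \<open>3\<close> is read off from its values at \<open>1\<close> and \<open>2\<close>.\<close>
definition S3_lift :: "('g, 'r) monoid_scheme \<Rightarrow> 'g \<Rightarrow> 'g \<Rightarrow> (3 \<Rightarrow> 3) \<Rightarrow> 'g" where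
  "S3_lift H a b w =
     (if w 1 = 1 then (if w 2 = 2 then \<one>\<^bsub>H\<^esub> else b)
      else if w 1 = 2 then (if w 2 = 1 then a else a \<otimes>\<^bsub>H\<^esub> b)
      else (if w 2 = 1 then b \<otimes>\<^bsub>H\<^esub> a else a \<otimes>\<^bsub>H\<^esub> (b \<otimes>\<^bsub>H\<^esub> a)))"

lemma S3_lift_values:
  "S3_lift H a b id = \<one>\<^bsub>H\<^esub>" "S3_lift H a b s12 = a" "S3_lift H a b s23 = b"
  "S3_lift H a b (s12 \<circ> s23) = a \<otimes>\<^bsub>H\<^esub> b" "S3_lift H a b (s23 \<circ> s12) = b \<otimes>\<^bsub>H\<^esub> a"
  "S3_lift H a b w0 = a \<otimes>\<^bsub>H\<^esub> (b \<otimes>\<^bsub>H\<^esub> a)"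
  by (simp_all add: S3_lift_def S3_values numeral_3_distinct)

lemma carrier_S3: "carrier S3 = {w. bij w}"
  by (simp add: BijGroup_def Bij_def)

lemma mult_S3: "bij v \<Longrightarrow> bij w \<Longrightarrow> v \<otimes>\<^bsub>S3\<^esub> w = v \<circ> w"
  by (simp add: BijGroup_def Bij_def compose_def fun_eq_iff)

section \<open>Two involutions with the braid relation define a homomorphism from S_3\<close>

context group
begin

context
  fixes a b
  assumes a: "a \<in> carrier G" and b: "b \<in> carrier G"
    and aa: "a \<otimes> a = \<one>" and bb: "b \<otimes> b = \<one>"
    and braid: "a \<otimes> (b \<otimes> a) = b \<otimes> (a \<otimes> b)"
begin

lemma S3_lift_closed: "S3_lift G a b w \<in> carrier G"
  using a b by (simp add: S3_lift_def)

text \<open>On the chosen reduced words, left multiplication by \<open>s12\<close> either prepends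
  the letter \<open>a\<close> or cancels a leading one.\<close>

lemma S3_lift_s12:
  assumes "bij w"
  shows "S3_lift G a b (s12 \<circ> w) = a \<otimes> S3_lift G a b w"
proof -
  have aax: "a \<otimes> (a \<otimes> x) = x" if "x \<in> carrier G" for x
    using a that aa by (simp flip: m_assoc)
  from assms show ?thesis
    by (cases rule: S3_cases) (simp_all add: S3_table S3_lift_values aa a b aax)
qed

text \<open>Here the braid relation enters: the word chosen for \<open>w0\<close> begins with
  \<open>a\<close>, so it must be rewritten to begin with \<open>b\<close>.\<close>

lemma S3_lift_s23:
  assumes "bij w"
  shows "S3_lift G a b (s23 \<circ> w) = b \<otimes> S3_lift G a b w"
proof -
  have bbx: "b \<otimes> (b \<otimes> x) = x" if "x \<in> carrier G" for x
    using b that bb by (simp flip: m_assoc)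
  from assms show ?thesis
    by (cases rule: S3_cases) (simp_all add: S3_table S3_lift_values bb a b bbx braid)
qed

lemma S3_lift_comp:
  "bij v \<Longrightarrow> bij w \<Longrightarrow> S3_lift G a b (v \<circ> w) = S3_lift G a b v \<otimes> S3_lift G a b w"
proof (induction rule: S3_induct)
  case id
  then show ?case by (simp only: id_comp S3_lift_values S3_lift_closed l_one)
qed (simp_all add: comp_assoc S3_lift_s12 S3_lift_s23 bij_comp m_assoc a b S3_lift_closed)

lemma S3_lift_hom: "group_hom S3 G (S3_lift G a b)"
  by (intro group_hom.intro group_hom_axioms.intro group_BijGroup is_group homI)
    (simp_all add: S3_lift_closed carrier_S3 mult_S3 S3_lift_comp)

lemma S3_lift_image: "S3_lift G a b ` carrier S3 = generate G {a, b}"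
proof
  show "S3_lift G a b ` carrier S3 \<subseteq> generate G {a, b}"
  proof (intro image_subsetI)
    fix w assume "w \<in> carrier S3"
    then have "bij w" by (simp add: carrier_S3)
    then show "S3_lift G a b w \<in> generate G {a, b}"
    proof (induction rule: S3_induct)
      case id
      show ?case unfolding S3_lift_values by (rule generate.one)
    next
      case (s12 w)
      show ?case
        unfolding S3_lift_s12[OF s12(1)] by (intro generate.eng generate.incl s12) simp
    next
      case (s23 w)
      show ?case
        unfolding S3_lift_s23[OF s23(1)] by (intro generate.eng generate.incl s23) simp
    qed
  qed
  have "{a, b} \<subseteq> S3_lift G a b ` carrier S3"
    using image_eqI[of a "S3_lift G a b" s12 "carrier S3"]
      image_eqI[of b "S3_lift G a b" s23 "carrier S3"]
    by (simp add: S3_lift_values carrier_S3 bij_s12 bij_s23)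
  then show "generate G {a, b} \<subseteq> S3_lift G a b ` carrier S3"
    by (rule generate_subgroup_incl) (rule group_hom.img_is_subgroup[OF S3_lift_hom])
qed

end

end

section \<open>The action on \<open>S'\<close>\<close>

lemma restrict_involution_Bij:
  assumes "\<And>x. x \<in> A \<Longrightarrow> F x \<in> A" "\<And>x. x \<in> A \<Longrightarrow> F (F x) = x"
  shows "restrict F A \<in> Bij A"
proof -
  have "bij_betw F A A"
    by (rule bij_betw_byWitness[where f' = F]) (use assms in auto)
  then show ?thesis by (simp add: Bij_def cong: bij_betw_cong)
qed

theorem theorem7p3:
  fixes \<psi> :: "'a::{field,finite} \<Rightarrow> complex"
  assumes "nontrivial_additive_character \<psi>"
  shows "\<exists>\<F> :: (3 \<Rightarrow> 3) \<Rightarrow> ('a pt \<Rightarrow> complex) \<Rightarrow> ('a pt \<Rightarrow> complex).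
      group_action S3 S' \<F>
    \<and> (\<forall>w\<in>carrier S3. \<forall>f\<in>S'. \<forall>h\<in>S'. \<forall>a b.
         \<F> w (\<lambda>x. a * f x + b * h x) = (\<lambda>x. a * \<F> w f x + b * \<F> w h x))
    \<and> (\<forall>w\<in>carrier S3. \<forall>g\<in>SL3. \<forall>f\<in>S'. \<F> w (L g f) = L g (\<F> w f))
    \<and> (\<forall>w\<in>carrier S3. \<forall>t\<in>T. \<forall>f\<in>S'. \<F> w (R t f) = R (permT w t) (\<F> w f))
    \<and> \<F> ` carrier S3 = generate (BijGroup S') {restrict (F12 \<psi>) S', restrict (F23 \<psi>) S'}
    \<and> (\<forall>f\<in>S'. \<F> s12 f = F12 \<psi> f)
    \<and> (\<forall>f\<in>S'. \<F> s23 f = F23 \<psi> f)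
    \<and> (\<forall>f\<in>S'. \<F> w0 f = Fw0 \<psi> f)"
proof -
  let ?H = "BijGroup (S' :: ('a pt \<Rightarrow> complex) set)"
  \<comment> \<open>Elements of \<open>BijGroup\<close> are extensional, hence the restriction to
    \<open>S'\<close>.\<close>
  define a where "a = restrict (F12 \<psi>) S'"
  define b where "b = restrict (F23 \<psi>) S'"
  define \<F> where "\<F> = S3_lift ?H a b"
  interpret H: group ?H by (rule group_BijGroup)
  have ab: "a \<in> carrier ?H" "b \<in> carrier ?H"
    unfolding a_def b_def using assms
    by (simp_all add: BijGroup_def restrict_involution_Bij F12_S' F12_F12 F23_S' F23_F23)
  have mult: "g \<otimes>\<^bsub>?H\<^esub> h = compose S' g h" if "g \<in> carrier ?H" "h \<in> carrier ?H" for g h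
    using that by (simp add: BijGroup_def)
  have mult_apply: "(g \<otimes>\<^bsub>?H\<^esub> h) f = g (h f)" if "g \<in> carrier ?H" "h \<in> carrier ?H" "f \<in> S'" for g h f
    using that by (simp add: mult compose_eq)
  have ab_apply: "a f = F12 \<psi> f" "b f = F23 \<psi> f" if "f \<in> S'" for f
    using that by (simp_all add: a_def b_def)
  have eqI: "g = h" if "g \<in> carrier ?H" "h \<in> carrier ?H" "\<And>f. f \<in> S' \<Longrightarrow> g f = h f" for g h
    using that by (auto simp: BijGroup_def Bij_def intro: extensionalityI)
  have one_apply: "\<one>\<^bsub>?H\<^esub> f = f" if "f \<in> S'" for f
    using that by (simp add: BijGroup_def)
  note apply_simps = mult_apply one_apply ab ab_apply F12_S' F23_S'
  \<comment> \<open>On \<open>S'\<close> both braid words act as \<open>Fw0 \<psi>\<close>, which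
    gives the braid relation.\<close>
  have rel: "a \<otimes>\<^bsub>?H\<^esub> a = \<one>\<^bsub>?H\<^esub>" "b \<otimes>\<^bsub>?H\<^esub> b = \<one>\<^bsub>?H\<^esub>"
    "a \<otimes>\<^bsub>?H\<^esub> (b \<otimes>\<^bsub>?H\<^esub> a) = b \<otimes>\<^bsub>?H\<^esub> (a \<otimes>\<^bsub>?H\<^esub> b)"
    by (rule eqI; simp add: apply_simps F12_F12 F23_F23 F12_F23_F12 F23_F12_F23 assms)+
  note lift = H.S3_lift_closed[OF ab rel, folded \<F>_def] H.S3_lift_s12[OF ab rel, folded \<F>_def]
    H.S3_lift_s23[OF ab rel, folded \<F>_def]
  have S': "\<F> w f \<in> S'" if "f \<in> S'" for w f
    using lift(1)[of w] that by (auto simp: BijGroup_def dest: Bij_imp_funcset)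
  have id: "\<F> id f = f" if "f \<in> S'" for f
    using that by (simp add: \<F>_def S3_lift_values one_apply)
  have s12: "\<F> (s12 \<circ> w) f = F12 \<psi> (\<F> w f)" if "bij w" "f \<in> S'" for w f
    using that by (simp add: lift apply_simps S')
  have s23: "\<F> (s23 \<circ> w) f = F23 \<psi> (\<F> w f)" if "bij w" "f \<in> S'" for w f
    using that by (simp add: lift apply_simps S')
  have linear: "\<F> w (\<lambda>x. c * f x + d * h x) = (\<lambda>x. c * \<F> w f x + d * \<F> w h x)"
    if "bij w" "f \<in> S'" "h \<in> S'" for w f h c d
    using that by (induction rule: S3_induct) (simp_all add: id s12 s23 S'_linear F12_linear F23_linear)
  have G: "\<F> w (L g f) = L g (\<F> w f)" if "bij w" "g \<in> SL3" "f \<in> S'" for w g f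
    using that by (induction rule: S3_induct) (simp_all add: id s12 s23 L_S' F12_L F23_L)
  have T: "\<F> w (R t f) = R (permT w t) (\<F> w f)" if "bij w" "t \<in> T" "f \<in> S'" for w t f
    using that by (induction rule: S3_induct)
      (simp_all add: id s12 s23 R_S' F12_R F23_R permT_id permT_comp permT_T bij_s12 bij_s23)
  have "group_action S3 S' \<F>"
    unfolding group_action_def \<F>_def by (rule H.S3_lift_hom[OF ab rel])
  moreover have "\<F> ` carrier S3 = generate ?H {a, b}"
    unfolding \<F>_def by (rule H.S3_lift_image[OF ab rel])
  \<comment> \<open>The lift sends \<open>w0\<close> to the word a b a, and this acts as F12 F23
    F12.\<close>
  moreover have "\<F> s12 f = F12 \<psi> f" "\<F> s23 f = F23 \<psi> f" "\<F> w0 f = Fw0 \<psi> f" if "f \<in> S'" for f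
    using that by (simp_all add: \<F>_def S3_lift_values apply_simps F12_F23_F12 assms)
  ultimately show ?thesis
    using linear G T unfolding carrier_S3 a_def b_def by (intro exI[of _ \<F>]) simp
qed

end
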